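(* Let $A \leqslant B$ be real numbers and let $f : [A,B] \to \mathbb{R}$ be uniformly Lipschitz differentiable with derivative $f'$. If $f'(x) \geqslant 0$ for every $x$ with $A \leqslant x \leqslant B$, then $f(A) \leqslant f(B)$.
   Context: A function $f : I \to \mathbb{R}$ on an interval $I \subseteq \mathbb{R}$ is called uniformly Lipschitz differentiable (ULD) with derivative $f' : I \to \mathbb{R}$ if there is a constant $K$, independent of $x$ and $a$, such that $|f(x) - f(a) - f'(a)(x-a)| \leqslant K (x-a)^2$ for all $x, a \in I$. *)

theory Defs
  imports Complex_Main
begin

(* The set I plays the role of the interval on which f and its derivative f' live;
   the total functions f, f' are constrained only at points of I. *)
definition uniformly_Lipschitz_differentiable_on ::
  "real set \<Rightarrow> (real \<Rightarrow> real) \<Rightarrow> (real \<Rightarrow> real) \<Rightarrow> bool"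
  where
  "uniformly_Lipschitz_differentiable_on I f f' \<longleftrightarrow>
     (\<exists>K::real. \<forall>x\<in>I. \<forall>a\<in>I. \<bar>f x - f a - f' a * (x - a)\<bar> \<le> K * (x - a)\<^sup>2)"

end

theory Submission
  imports Defs
begin

text \<open>
  Going right from \<open>a\<close> to \<open>x\<close>, the linear term \<open>f' a * (x - a)\<close> is nonnegative, so \<open>f\<close> can drop by
  at most the quadratic error \<open>K * (x - a)\<^sup>2\<close>. Crossing \<open>[A,B]\<close> in \<open>n\<close> equal steps costs \<open>n\<close> such
  errors of size \<open>K * ((B - A) / n)\<^sup>2\<close>, in total \<open>K * (B - A)\<^sup>2 / n\<close>
  (\<open>f_ge_uniform_partition\<close>), which tends to \<open>0\<close>. The errors can be added up in this way because
  \<open>K\<close> is the same at every point of the interval.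
\<close>

lemma f_ge_equal_steps:
  fixes f :: "real \<Rightarrow> real"
  assumes drop: "\<And>a x. A \<le> a \<Longrightarrow> a \<le> x \<Longrightarrow> x \<le> B \<Longrightarrow> f x \<ge> f a - K * (x - a)\<^sup>2"
    and "0 \<le> h" and "A + real i * h \<le> B"
  shows "f (A + real i * h) \<ge> f A - real i * (K * h\<^sup>2)"
  using assms(3)
proof (induction i)
  case 0
  then show ?case by simp
next
  case (Suc i)
  have next_point: "A + real (Suc i) * h = (A + real i * h) + h"
    by (simp add: algebra_simps)
  have "f (A + real i * h) \<ge> f A - real i * (K * h\<^sup>2)"
    using Suc.prems \<open>0 \<le> h\<close> next_point by (intro Suc.IH) linarith
  moreover have "f (A + real (Suc i) * h) \<ge> f (A + real i * h) - K * h\<^sup>2"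
    using drop[of "A + real i * h" "(A + real i * h) + h"] Suc.prems \<open>0 \<le> h\<close>
    unfolding next_point by (simp del: of_nat_Suc)
  ultimately show ?case
    by (simp add: algebra_simps)
qed

lemma f_ge_uniform_partition:
  fixes f :: "real \<Rightarrow> real"
  assumes drop: "\<And>a x. A \<le> a \<Longrightarrow> a \<le> x \<Longrightarrow> x \<le> B \<Longrightarrow> f x \<ge> f a - K * (x - a)\<^sup>2"
    and "A \<le> B" and "n > 0"
  shows "f B \<ge> f A - K * (B - A)\<^sup>2 / real n"
proof -
  let ?h = "(B - A) / real n"
  have last_point: "A + real n * ?h = B"
    using \<open>n > 0\<close> by simp
  have total: "real n * (K * ?h\<^sup>2) = K * (B - A)\<^sup>2 / real n"
    using \<open>n > 0\<close> by (simp add: field_simps power2_eq_square)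
  have "f (A + real n * ?h) \<ge> f A - real n * (K * ?h\<^sup>2)"
    using \<open>A \<le> B\<close> last_point by (intro f_ge_equal_steps[where B = B] drop) auto
  then show ?thesis
    unfolding last_point total .
qed

theorem mainTheorem1:
  fixes A B :: real and f f' :: "real \<Rightarrow> real"
  assumes "A \<le> B"
    and "uniformly_Lipschitz_differentiable_on {A..B} f f'"
    and "\<And>x. A \<le> x \<Longrightarrow> x \<le> B \<Longrightarrow> f' x \<ge> 0"
  shows "f A \<le> f B"
proof -
  obtain K where K: "\<And>x a. x \<in> {A..B} \<Longrightarrow> a \<in> {A..B} \<Longrightarrow>
      \<bar>f x - f a - f' a * (x - a)\<bar> \<le> K * (x - a)\<^sup>2"
    using assms(2) unfolding uniformly_Lipschitz_differentiable_on_def by blast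
  have drop: "f x \<ge> f a - K * (x - a)\<^sup>2" if "A \<le> a" "a \<le> x" "x \<le> B" for a x
  proof -
    have "f' a * (x - a) \<ge> 0"
      using assms(3)[of a] that by simp
    then show ?thesis
      using K[of x a] that by auto
  qed
  have "(\<lambda>n. f A - K * (B - A)\<^sup>2 / real n) \<longlonglongrightarrow> f A - 0"
    by (intro tendsto_intros lim_const_over_n)
  moreover have "\<exists>N. \<forall>n\<ge>N. f A - K * (B - A)\<^sup>2 / real n \<le> f B"
    using f_ge_uniform_partition[of A B f K, OF drop \<open>A \<le> B\<close>]
    by (intro exI[of _ 1]) auto
  ultimately show ?thesis
    using LIMSEQ_le_const2 by fastforce
qed

end
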